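(* Let $N \ge 1$ and let $P(z) = \prod_{j=1}^{N} (z-\alpha_j) = z^N + a_{N-1} z^{N-1} + \cdots + a_0$ be a monic polynomial of degree $N$ with complex coefficients and with $a_0 \neq 0$, and write its roots (listed with multiplicity) as $\alpha_j = \rho_j e^{i\theta_j}$ with $\rho_j > 0$ and $\theta_j$ real. Then $$\mathcal{M}(P) \le \exp(2 h(P)),$$ where $$\mathcal{M}(P) = \prod_{j=1}^{N} \max\Big(\rho_j, \frac{1}{\rho_j}\Big), \qquad h(P) = \frac{1}{2\pi} \int_0^{2\pi} \log^+ \frac{|P(e^{i\theta})|}{\sqrt{|a_0|}}\, d\theta.$$
   Context: Here $\log^+ x = \max(0, \log x)$ for $x > 0$, with $\log^+ 0 = 0$. *)

theory Defs
  imports "HOL-Analysis.Analysis" "HOL-Computational_Algebra.Polynomial"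
begin

definition log_plus :: "real \<Rightarrow> real" where
  "log_plus x = (if x > 0 then max 0 (ln x) else 0)"

text \<open>The integrand is continuous on the compact interval, also at the zeros of the polynomial
  on the unit circle (there it vanishes locally), so the integral is never the default
  value of a non-integrable function.\<close>

definition height :: "complex poly \<Rightarrow> real" where
  "height P = 1 / (2 * pi) *
     integral {0..2 * pi} (\<lambda>t. log_plus (norm (poly P (cis t)) / sqrt (norm (coeff P 0))))"

text \<open>A function of the moduli, listed with multiplicity, of the roots of a polynomial
  of degree \<open>N\<close>.\<close>

definition root_measure :: "nat \<Rightarrow> (nat \<Rightarrow> real) \<Rightarrow> real" where
  "root_measure N \<rho> = (\<Prod>j=1..N. max (\<rho> j) (1 / \<rho> j))"

end

theory Submission
  imports Defs "HOL-Complex_Analysis.Complex_Analysis"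
begin

text \<open>Reflecting the roots inside the unit disc across the circle replaces \<open>P\<close> by a polynomial
  \<open>Q\<close> with \<open>\<bar>Q\<bar> = \<bar>P\<bar>\<close> on the circle, without zeros in the open disc, and with
  \<open>\<bar>Q(0)\<bar>\<close> equal to the Mahler measure of \<open>P\<close>. Since \<open>max(\<rho>, 1/\<rho>) = max(1, \<rho>)\<^sup>2 / \<rho>\<close>,
  the product \<open>\<M>(P)\<close> is \<open>\<bar>Q(0)\<bar>\<^sup>2 / \<bar>a\<^sub>0\<bar>\<close>. The claim is then the mean value
  inequality for \<open>log\<^sup>+ \<bar>Q / \<surd>\<bar>a\<^sub>0\<bar>\<bar>\<close>: on circles of radius \<open>r < 1\<close> the function
  \<open>log \<bar>Q\<bar>\<close> is harmonic, and \<open>log\<^sup>+\<close>, unlike \<open>log\<close>, extends continuously to radius \<open>1\<close> even if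
  \<open>Q\<close> vanishes there.\<close>

text \<open>Here the argument of \<open>ln\<close> stays at least 1, so continuity holds even where
  the inner function vanishes.\<close>

lemma log_plus_eq_ln_max: "log_plus x = ln (max 1 x)"
  by (auto simp: log_plus_def max_def)

lemma continuous_on_log_plus [continuous_intros]:
  "continuous_on S f \<Longrightarrow> continuous_on S (\<lambda>x. log_plus (f x))"
  unfolding log_plus_eq_ln_max by (intro continuous_intros) (auto simp: max_def)

text \<open>A zero-free holomorphic function on a disc is \<open>exp (g z)\<close> with
  \<open>g\<close> holomorphic, so \<open>ln (norm (f z))\<close> is the real part of
  \<open>g\<close>, and Cauchy's formula for \<open>g\<close> at the centre gives the mean
  value.\<close>

lemma ln_norm_mean_value:
  fixes f :: "complex \<Rightarrow> complex"
  assumes hol: "f holomorphic_on ball 0 R" and nz: "\<And>z. z \<in> ball 0 R \<Longrightarrow> f z \<noteq> 0"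
    and r: "0 < r" "r < R"
  shows "((\<lambda>t. ln (norm (f (of_real r * cis t)))) has_integral (2 * pi * ln (norm (f 0)))) {0..2*pi}"
proof -
  obtain g where g: "g holomorphic_on ball 0 R" "\<And>z. z \<in> ball 0 R \<Longrightarrow> f z = exp (g z)"
    using contractible_imp_holomorphic_log[OF hol _ nz] convex_imp_contractible by blast
  have ln_f: "ln (norm (f z)) = Re (g z)" if "z \<in> ball 0 R" for z
    using g(2)[OF that] by simp
  have "((\<lambda>u. g u / (u - 0)) has_contour_integral (2 * of_real pi * \<i> * g 0)) (circlepath 0 r)"
    using r by (intro Cauchy_integral_circlepath_simple holomorphic_on_subset[OF g(1)]) auto
  then have "((\<lambda>t. g (of_real r * cis t) / (of_real r * cis t) * of_real r * \<i> * cis t)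
      has_integral (2 * of_real pi * \<i> * g 0)) {0..2*pi}"
    by (simp add: circlepath_def has_contour_integral_part_circlepath_iff)
  then have "((\<lambda>t. \<i> * g (of_real r * cis t)) has_integral (2 * of_real pi * \<i> * g 0)) {0..2*pi}"
    by (rule has_integral_eq[rotated]) (use r in \<open>simp add: field_simps\<close>)
  \<comment> \<open>Parametrizing the circle leaves a factor \<open>\<i>\<close>, so imaginary parts
    here are real parts of \<open>g\<close>.\<close>
  from has_integral_Im[OF this]
  have "((\<lambda>t. Re (g (of_real r * cis t))) has_integral (2 * pi * Re (g 0))) {0..2*pi}"
    by simp
  moreover have "of_real r * cis t \<in> ball 0 R" for t
    using r by (simp add: norm_mult)
  ultimately show ?thesis
    using r by (simp add: ln_f)
qed

lemma log_plus_norm_mean_value_le: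
  fixes f :: "complex \<Rightarrow> complex"
  assumes cont: "continuous_on (cball 0 1) f" and hol: "f holomorphic_on ball 0 1"
    and nz: "\<And>z. z \<in> ball 0 1 \<Longrightarrow> f z \<noteq> 0"
  shows "2 * pi * ln (norm (f 0)) \<le> integral {0..2*pi} (\<lambda>t. log_plus (norm (f (cis t))))"
proof -
  define I where "I = (\<lambda>r. integral {0..2*pi} (\<lambda>t. log_plus (norm (f (of_real r * cis t)))))"
  have cont_f: "continuous_on ({0..1} \<times> {0..2*pi}) (\<lambda>x. f (of_real (fst x) * cis (snd x)))"
    by (rule continuous_on_compose2[OF cont]) (auto intro!: continuous_intros simp: norm_mult)
  \<comment> \<open>Joint continuity on the closed rectangle makes \<open>I\<close> continuous up to
    radius 1, which permits the limit from the left below.\<close>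
  have "continuous_on ({0..1} \<times> cbox 0 (2*pi))
      (\<lambda>(r, t). log_plus (norm (f (of_real r * cis t))))"
    unfolding case_prod_unfold cbox_interval by (intro continuous_intros cont_f)
  from integral_continuous_on_param[OF this] have contI: "continuous_on {0..1} I"
    by (simp add: I_def)
  have le: "2 * pi * ln (norm (f 0)) \<le> I r" if r: "r \<in> {0<..<1}" for r
  proof -
    have "(\<lambda>t. log_plus (norm (f (of_real r * cis t)))) integrable_on {0..2*pi}"
      using r by (intro integrable_continuous_real continuous_intros
          continuous_on_compose2[OF cont]) (auto simp: norm_mult)
    then have "((\<lambda>t. log_plus (norm (f (of_real r * cis t)))) has_integral I r) {0..2*pi}"
      by (simp add: I_def integrable_integral)
    moreover have "ln (norm (f (of_real r * cis t))) \<le> log_plus (norm (f (of_real r * cis t)))" for t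
      using r nz[of "of_real r * cis t"] by (simp add: log_plus_def norm_mult)
    ultimately show ?thesis
      using r by (intro has_integral_le[OF ln_norm_mean_value[OF hol nz, of r]]) auto
  qed
  have "(I \<longlongrightarrow> I 1) (at_left 1)"
    using contI by (simp add: continuous_on_Icc_at_leftD)
  moreover have "eventually (\<lambda>r. 2 * pi * ln (norm (f 0)) \<le> I r) (at_left 1)"
    using eventually_at_left_real[of 0 "1::real"] by (rule eventually_mono) (use le in auto)
  ultimately have "2 * pi * ln (norm (f 0)) \<le> I 1"
    by (intro tendsto_lowerbound) auto
  then show ?thesis
    by (simp add: I_def)
qed

text \<open>For a nonzero \<open>a\<close> in the closed disc the new zero is
  \<open>1 / cnj a\<close>, the mirror image of \<open>a\<close> in the unit circle. Writing the
  factor without a quotient also covers \<open>a = 0\<close>.\<close>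

definition reflect_factor :: "complex \<Rightarrow> complex \<Rightarrow> complex" where
  "reflect_factor a z = (if norm a \<le> 1 then 1 - cnj a * z else z - a)"

lemma norm_reflect_factor_0: "norm (reflect_factor a 0) = max 1 (norm a)"
  by (simp add: reflect_factor_def)

lemma norm_reflect_factor_circle:
  assumes "norm z = 1"
  shows "norm (reflect_factor a z) = norm (z - a)"
proof -
  have "z * cnj z = 1"
    using assms by (simp flip: complex_norm_square)
  \<comment> \<open>Replace the 1 by \<open>z * cnj z\<close>.\<close>
  then have "1 - cnj a * z = z * cnj (z - a)"
    by (simp add: algebra_simps)
  then have "norm (1 - cnj a * z) = norm (z - a)"
    using assms by (simp only: norm_mult complex_mod_cnj mult_1)
  then show ?thesis
    by (simp add: reflect_factor_def)
qed

lemma reflect_factor_nonzero: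
  assumes "norm z < 1"
  shows "reflect_factor a z \<noteq> 0"
proof (cases "norm a \<le> 1")
  case True
  then have "norm (cnj a * z) < 1"
    using assms mult_le_one[of "norm a" "norm z"] mult_right_mono[of "norm a" 1 "norm z"]
    by (simp add: norm_mult)
  then show ?thesis
    using True by (auto simp: reflect_factor_def)
qed (use assms in \<open>auto simp: reflect_factor_def\<close>)

lemma holomorphic_on_reflect_factor [holomorphic_intros]: "reflect_factor a holomorphic_on S"
  unfolding reflect_factor_def by (cases "norm a \<le> 1") (auto intro!: holomorphic_intros)

theorem theorem1:
  fixes N :: nat and P :: "complex poly" and \<alpha> :: "nat \<Rightarrow> complex"
    and \<rho> \<theta> :: "nat \<Rightarrow> real"
  assumes "N \<ge> 1"
    and "P = (\<Prod>j=1..N. [:- \<alpha> j, 1:])"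
    and "coeff P 0 \<noteq> 0"
    and "\<And>j. j \<in> {1..N} \<Longrightarrow> \<rho> j > 0"
    and "\<And>j. j \<in> {1..N} \<Longrightarrow> \<alpha> j = rcis (\<rho> j) (\<theta> j)"
  shows "root_measure N \<rho> \<le> exp (2 * height P)"
proof -
  define c where "c = sqrt (norm (coeff P 0))"
  \<comment> \<open>Dividing by \<open>c\<close> makes \<open>norm (Q z)\<close> on the circle
    exactly the argument of \<open>log_plus\<close> in \<open>height\<close>.\<close>
  define Q where "Q = (\<lambda>z. (\<Prod>j=1..N. reflect_factor (\<alpha> j) z) / of_real c)"
  have c: "c > 0"
    using assms(3) by (simp add: c_def)
  have norm_\<alpha>: "norm (\<alpha> j) = \<rho> j" if "j \<in> {1..N}" for j
    using assms(4,5)[OF that] by simp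
  have norm_Q_0: "norm (Q 0) = (\<Prod>j=1..N. max 1 (\<rho> j)) / c"
    using c by (simp add: Q_def norm_divide norm_reflect_factor_0 norm_\<alpha> flip: prod_norm)
  \<comment> \<open>Up to sign, the constant coefficient is the product of the roots.\<close>
  have c_sq: "c\<^sup>2 = (\<Prod>j=1..N. \<rho> j)"
    by (simp add: c_def assms(2) poly_prod norm_\<alpha> flip: poly_0_coeff_0 prod_norm)
      (rule prod_nonneg, use assms(4) in \<open>force simp: less_imp_le\<close>)
  have "max (\<rho> j) (1 / \<rho> j) = (max 1 (\<rho> j))\<^sup>2 / \<rho> j" if "j \<in> {1..N}" for j
  proof (cases "\<rho> j \<le> 1")
    case True
    then have "\<rho> j * \<rho> j \<le> 1"
      using assms(4)[OF that] by (intro mult_le_one) auto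
    then show ?thesis
      using True assms(4)[OF that] by (simp add: max_def field_simps)
  next
    case False
    then have "1 \<le> \<rho> j * \<rho> j"
      using mult_mono[of 1 "\<rho> j" 1 "\<rho> j"] by simp
    then show ?thesis
      using False assms(4)[OF that] by (simp add: max_def field_simps power2_eq_square)
  qed
  then have "root_measure N \<rho> = (norm (Q 0))\<^sup>2"
    by (simp add: root_measure_def norm_Q_0 power_divide c_sq prod_dividef prod_power_distrib)
  moreover have "2 * pi * ln (norm (Q 0)) \<le> integral {0..2*pi} (\<lambda>t. log_plus (norm (Q (cis t))))"
  proof (rule log_plus_norm_mean_value_le)
    have hol: "Q holomorphic_on S" for S
      unfolding Q_def using c by (intro holomorphic_intros) auto
    then show "continuous_on (cball 0 1) Q" "Q holomorphic_on ball 0 1"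
      by (auto intro: holomorphic_on_imp_continuous_on)
    show "Q z \<noteq> 0" if "z \<in> ball 0 1" for z
      using that c by (simp add: Q_def reflect_factor_nonzero)
  qed
  moreover have "norm (Q (cis t)) = norm (poly P (cis t)) / c" for t
    using c by (simp add: Q_def norm_divide assms(2) poly_prod norm_reflect_factor_circle
        flip: prod_norm)
  ultimately have "ln (norm (Q 0)) \<le> height P"
    by (simp add: height_def c_def field_simps)
  \<comment> \<open>Positivity allows \<open>ln\<close> to be undone by \<open>exp\<close>; squaring
    then yields the factor 2 in the exponent.\<close>
  moreover have "norm (Q 0) > 0"
    using c by (auto simp: norm_Q_0 intro!: divide_pos_pos prod_pos)
  ultimately have "norm (Q 0) \<le> exp (height P)"
    by (metis exp_le_cancel_iff exp_ln)
  then show ?thesis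
    using \<open>root_measure N \<rho> = (norm (Q 0))\<^sup>2\<close> by (simp add: exp_double power_mono)
qed

end
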